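(* Let $m,l$ be positive integers and let $\mathbf{U}^\sigma$ be the $ml\times ml$ matrix of the linear transformation $\sigma$ acting on flattened $m\times l$ matrices. Then $\mathbf{U}^\sigma$ has at most $2\cdot\min(m,l)-1$ non-zero diagonals, no matter whether matrices are flattened in column-major order or in row-major order.
   Context: All indices start at $0$, and $[x]_y$ denotes $x\bmod y\in\{0,\dots,y-1\}$. Matrices have entries in a commutative ring $R$. For an $m\times l$ matrix $\mathcal{A}$, $\sigma(\mathcal{A})$ is the $m\times l$ matrix with $\sigma(\mathcal{A})_{i,j}=\mathcal{A}_{i,[i+j]_l}$ for $0\le i<m$, $0\le j<l$. Flattening: an $a\times b$ matrix is flattened to a vector of length $ab$; in column-major order its $(i,j)$ entry is placed at position $i+j\cdot a$, and in row-major order at position $i\cdot b+j$. $\mathbf{U}^\sigma$ is the $0/1$ matrix that sends the flattening of $\mathcal{A}$ to the flattening of $\sigma(\mathcal{A})$ (same flattening order for both) for every $\mathcal{A}$. That is, the row of $\mathbf{U}^\sigma$ indexed by the position of $(i,j)$ has its single entry $1$ in the column indexed by the position of $(i,[i+j]_l)$. In column-major order this reads $\mathbf{U}^\sigma_{i+jm,\,h}=1$ if $h=i+[i+j]_l\cdot m$ and $0$ otherwise. Diagonals: for a $y\times x$ matrix $U$ and an integer $z$ with $-y\le z<x$, the $z$-th diagonal consists of the entries $U_{r,c}$ with $c-r=z$ (no cyclic wrap-around); it is non-zero if at least one of these entries is non-zero. *)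

theory Defs
  imports Jordan_Normal_Form.Matrix
begin

definition sigma :: "'a mat \<Rightarrow> 'a mat" where
  "sigma A = mat (dim_row A) (dim_col A) (\<lambda>(i, j). A $$ (i, (i + j) mod dim_col A))"

datatype flat_order = Column_Major | Row_Major

fun flat_pos :: "flat_order \<Rightarrow> nat \<Rightarrow> nat \<Rightarrow> nat \<times> nat \<Rightarrow> nat" where
  "flat_pos Column_Major a b (i, j) = i + j * a"
| "flat_pos Row_Major a b (i, j) = i * b + j"

definition flatten :: "flat_order \<Rightarrow> 'a mat \<Rightarrow> 'a vec" where
  "flatten ord A = vec (dim_row A * dim_col A)
     (\<lambda>k. A $$ inv_into ({..<dim_row A} \<times> {..<dim_col A}) (flat_pos ord (dim_row A) (dim_col A)) k)"

definition U_sigma :: "flat_order \<Rightarrow> nat \<Rightarrow> nat \<Rightarrow> 'a::{zero, one} mat" where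
  "U_sigma ord m l = mat (m * l) (m * l) (\<lambda>(r, c).
     if \<exists>i<m. \<exists>j<l. r = flat_pos ord m l (i, j) \<and> c = flat_pos ord m l (i, (i + j) mod l)
     then 1 else 0)"

definition diagonal_entries :: "'a mat \<Rightarrow> int \<Rightarrow> 'a set" where
  "diagonal_entries U z = {U $$ (r, c) | r c. r < dim_row U \<and> c < dim_col U \<and> int c - int r = z}"

definition nonzero_diagonals :: "'a::zero mat \<Rightarrow> int set" where
  "nonzero_diagonals U =
     {z. - int (dim_row U) \<le> z \<and> z < int (dim_col U) \<and> (\<exists>u \<in> diagonal_entries U z. u \<noteq> 0)}"

text \<open>The remaining facts confirm that \<open>U_sigma\<close> is the matrix of \<open>sigma\<close> on flattened
  matrices, and the only one. The sort \<open>{comm_ring, monoid_mult}\<close> is that of commutative rings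
  with 1; unlike \<open>comm_ring_1\<close> it also admits the zero ring.\<close>

lemma flat_pos_bij:
  "bij_betw (flat_pos ord a b) ({..<a} \<times> {..<b}) {..<a * b}"
proof (cases ord)
  case Column_Major
  show ?thesis unfolding Column_Major
  proof (rule bij_betw_byWitness[where f' = "\<lambda>k. (k mod a, k div a)"])
    show "flat_pos Column_Major a b ` ({..<a} \<times> {..<b}) \<subseteq> {..<a * b}"
    proof clarsimp
      fix i j assume "i < a" "j < b"
      then have "i + j * a < (j + 1) * a" "(j + 1) * a \<le> b * a"
        by (simp, intro mult_le_mono1, simp)
      then show "i + j * a < a * b" by (simp add: mult.commute)
    qed
    show "(\<lambda>k. (k mod a, k div a)) ` {..<a * b} \<subseteq> {..<a} \<times> {..<b}"
      by (cases "a = 0") (auto simp: less_mult_imp_div_less mult.commute)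
  qed auto
next
  case Row_Major
  show ?thesis unfolding Row_Major
  proof (rule bij_betw_byWitness[where f' = "\<lambda>k. (k div b, k mod b)"])
    show "flat_pos Row_Major a b ` ({..<a} \<times> {..<b}) \<subseteq> {..<a * b}"
    proof clarsimp
      fix i j assume "i < a" "j < b"
      then have "i * b + j < (i + 1) * b" "(i + 1) * b \<le> a * b"
        by (simp, intro mult_le_mono1, simp)
      then show "i * b + j < a * b" by simp
    qed
    show "(\<lambda>k. (k div b, k mod b)) ` {..<a * b} \<subseteq> {..<a} \<times> {..<b}"
      by (cases "b = 0") (auto simp: less_mult_imp_div_less)
  qed auto
qed

lemma flat_pos_less:
  "i < a \<Longrightarrow> j < b \<Longrightarrow> flat_pos ord a b (i, j) < a * b"
  using bij_betwE[OF flat_pos_bij[of ord a b]] by auto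

lemma flat_pos_eq_iff:
  "i < a \<Longrightarrow> j < b \<Longrightarrow> i' < a \<Longrightarrow> j' < b \<Longrightarrow>
   flat_pos ord a b (i, j) = flat_pos ord a b (i', j') \<longleftrightarrow> i = i' \<and> j = j'"
  using inj_on_eq_iff[OF bij_betw_imp_inj_on[OF flat_pos_bij[of ord a b]], of "(i, j)" "(i', j')"]
  by auto

lemma flat_pos_cases:
  assumes "k < a * b"
  obtains i j where "i < a" "j < b" "k = flat_pos ord a b (i, j)"
  using assms bij_betw_imp_surj_on[OF flat_pos_bij[of ord a b]]
  by (metis (no_types, lifting) SigmaE imageE lessThan_iff)

lemma flatten_index:
  assumes "A \<in> carrier_mat a b" "i < a" "j < b"
  shows "flatten ord A $ flat_pos ord a b (i, j) = A $$ (i, j)"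
  using assms flat_pos_less[of i a j b ord]
    inv_into_f_f[OF bij_betw_imp_inj_on[OF flat_pos_bij[of ord a b]], of "(i, j)"]
  by (auto simp: flatten_def)

lemma flatten_surj:
  assumes "v \<in> carrier_vec (a * b)"
  obtains A where "A \<in> carrier_mat a b" "flatten ord A = v"
proof
  let ?A = "mat a b (\<lambda>ij. v $ flat_pos ord a b ij)"
  show A: "?A \<in> carrier_mat a b" by simp
  show "flatten ord ?A = v"
  proof (rule eq_vecI)
    fix k assume "k < dim_vec v"
    then obtain i j where "i < a" "j < b" "k = flat_pos ord a b (i, j)"
      using assms flat_pos_cases[of k a b ord] by auto
    then show "flatten ord ?A $ k = v $ k"
      using flatten_index[OF A] by simp
  qed (use assms in \<open>simp add: flatten_def\<close>)
qed

lemma U_sigma_flatten: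
  fixes A :: "'a::{comm_ring, monoid_mult} mat"
  assumes A: "A \<in> carrier_mat m l"
  shows "U_sigma ord m l *\<^sub>v flatten ord A = flatten ord (sigma A)"
proof (rule eq_vecI)
  fix k assume "k < dim_vec (flatten ord (sigma A))"
  then have k: "k < m * l" using A by (simp add: flatten_def sigma_def)
  then obtain i j where ij: "i < m" "j < l" and kij: "k = flat_pos ord m l (i, j)"
    by (rule flat_pos_cases)
  let ?c = "flat_pos ord m l (i, (i + j) mod l)"
  have jl: "(i + j) mod l < l" using ij by simp
  have c: "?c < m * l" using ij jl by (intro flat_pos_less)
  have U: "U_sigma ord m l $$ (k, c) = (if c = ?c then 1 else 0 :: 'a)" if "c < m * l" for c
  proof -
    have "(\<exists>i'<m. \<exists>j'<l. k = flat_pos ord m l (i', j') \<and> c = flat_pos ord m l (i', (i' + j') mod l))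
        \<longleftrightarrow> c = ?c"
      using ij unfolding kij by (auto simp: flat_pos_eq_iff)
    then show ?thesis using k that by (simp add: U_sigma_def)
  qed
  have "(U_sigma ord m l *\<^sub>v flatten ord A) $ k
      = (\<Sum>c = 0..<m * l. U_sigma ord m l $$ (k, c) * flatten ord A $ c)"
    using k A by (simp add: U_sigma_def scalar_prod_def flatten_def)
  also have "\<dots> = (\<Sum>c = 0..<m * l. if c = ?c then flatten ord A $ c else 0)"
    by (rule sum.cong) (auto simp: U)
  also have "\<dots> = flatten ord A $ ?c" using c by simp
  also have "\<dots> = A $$ (i, (i + j) mod l)" using A ij jl by (intro flatten_index)
  also have "\<dots> = flatten ord (sigma A) $ k"
    using A ij unfolding kij by (subst flatten_index[of _ m l]) (auto simp: sigma_def)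
  finally show "(U_sigma ord m l *\<^sub>v flatten ord A) $ k = flatten ord (sigma A) $ k" .
qed (use A in \<open>simp add: flatten_def sigma_def U_sigma_def\<close>)

lemma U_sigma_unique:
  fixes U :: "'a::{comm_ring, monoid_mult} mat"
  assumes U: "U \<in> carrier_mat (m * l) (m * l)"
    and eq: "\<And>A. A \<in> carrier_mat m l \<Longrightarrow> U *\<^sub>v flatten ord A = flatten ord (sigma A)"
  shows "U = U_sigma ord m l"
proof (rule eq_matI)
  let ?V = "U_sigma ord m l :: 'a mat"
  have V: "?V \<in> carrier_mat (m * l) (m * l)" by (simp add: U_sigma_def)
  fix r c assume "r < dim_row ?V" "c < dim_col ?V"
  then have rc: "r < m * l" "c < m * l" using V by auto
  let ?e = "vec (m * l) (\<lambda>k. if k = c then 1 else 0) :: 'a vec"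
  have "?e \<in> carrier_vec (m * l)" by simp
  then obtain A :: "'a mat" where "A \<in> carrier_mat m l" "flatten ord A = ?e"
    by (rule flatten_surj)
  then have "U *\<^sub>v ?e = ?V *\<^sub>v ?e" using eq[of A] U_sigma_flatten[of A m l ord] by metis
  moreover have "(W *\<^sub>v ?e) $ r = W $$ (r, c)" if W: "W \<in> carrier_mat (m * l) (m * l)" for W
  proof -
    have "(W *\<^sub>v ?e) $ r = (\<Sum>k = 0..<m * l. W $$ (r, k) * (if k = c then 1 else 0))"
      using W rc by (simp add: scalar_prod_def)
    also have "\<dots> = (\<Sum>k = 0..<m * l. if k = c then W $$ (r, k) else 0)"
      by (rule sum.cong) auto
    finally show ?thesis using rc by simp
  qed
  ultimately show "U $$ (r, c) = ?V $$ (r, c)" using U V by metis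
qed (use U in \<open>simp_all add: U_sigma_def\<close>)

end

(* Every entry 1 of U_sigma lies on the diagonal k * d, where k is 1 or m depending on the
   flattening order and d = ((i + j) mod l) - j for some i < m, j < l. There are at most
   2 l - 1 values of d because -l < d < l, and at most 2 m - 1 because d is i mod l or
   i mod l - l, and d = 0 for i = 0. *)
theory Submission
  imports Defs
begin

text \<open>These are the signed column displacements of \<open>sigma\<close>. They do not depend on
  the flattening order, so one count serves both orders.\<close>

definition shifts :: "nat \<Rightarrow> nat \<Rightarrow> int set" where
  "shifts m l = (\<lambda>(i, j). int ((i + j) mod l) - int j) ` ({..<m} \<times> {..<l})"

lemma finite_shifts: "finite (shifts m l)"
  by (simp add: shifts_def)

lemma card_shifts_le_cols:
  assumes "0 < l"
  shows "card (shifts m l) \<le> 2 * l - 1"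
proof -
  have "shifts m l \<subseteq> {- int l<..<int l}"
  proof
    fix d assume "d \<in> shifts m l"
    then obtain i j where "j < l" and d: "d = int ((i + j) mod l) - int j"
      by (auto simp: shifts_def)
    moreover have "(i + j) mod l < l" using assms by simp
    ultimately show "d \<in> {- int l<..<int l}" unfolding greaterThanLessThan_iff by linarith
  qed
  then have "card (shifts m l) \<le> card {- int l<..<int l}"
    by (intro card_mono) auto
  also have "\<dots> = 2 * l - 1" by simp
  finally show ?thesis .
qed

text \<open>Two residues below \<open>l\<close> add up to less than \<open>2 * l\<close>, so the
  column index wraps around at most once. Hence a row contributes at most two shifts, whatever the
  column.\<close>

lemma shift_cases:
  fixes i j l :: nat
  assumes "j < l"
  shows "int ((i + j) mod l) - int j \<in> {int (i mod l), int (i mod l) - int l}"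
proof -
  let ?k = "i mod l"
  have k: "?k < l" using assms by simp
  \<comment> \<open>Here \<open>i\<close> may exceed \<open>l\<close>, so it is reduced first; only
    then does a single subtraction of \<open>l\<close> suffice.\<close>
  have mod_eq: "(i + j) mod l = (?k + j) mod l" by (simp only: mod_add_left_eq)
  show ?thesis
  proof (cases "?k + j < l")
    case True
    then show ?thesis unfolding mod_eq by simp
  next
    case False
    then have "(?k + j) mod l = (?k + j - l) mod l" by (simp only: le_mod_geq not_less)
    also have "\<dots> = ?k + j - l" using k assms by (intro mod_less) linarith
    finally show ?thesis unfolding mod_eq using False by (simp add: of_nat_diff)
  qed
qed

lemma card_shifts_le_rows:
  assumes "0 < m"
  shows "card (shifts m l) \<le> 2 * m - 1"
proof -
  \<comment> \<open>\<open>?P\<close> collects the shifts without wrap-around and \<open>?N\<close>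
    those with it. Row 0 is left out: there \<open>j mod l = j\<close>, so its only shift is
    0.\<close>
  let ?P = "(\<lambda>i. int (i mod l)) ` {1..<m}"
  let ?N = "(\<lambda>i. int (i mod l) - int l) ` {1..<m}"
  have "shifts m l \<subseteq> insert 0 (?P \<union> ?N)"
  proof
    fix d assume "d \<in> shifts m l"
    then obtain i j where ij: "i < m" "j < l" and d: "d = int ((i + j) mod l) - int j"
      by (auto simp: shifts_def)
    show "d \<in> insert 0 (?P \<union> ?N)"
    proof (cases "i = 0")
      case False
      then have "i \<in> {1..<m}" using ij by simp
      then show ?thesis using shift_cases[OF ij(2), of i] d by blast
    qed (use ij d in simp)
  qed
  then have "card (shifts m l) \<le> card (insert 0 (?P \<union> ?N))"
    by (intro card_mono) auto
  also have "\<dots> \<le> Suc (card ?P + card ?N)"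
    using card_insert_le_m1 card_Un_le[of ?P ?N] by (simp add: card_insert_if)
  also have "\<dots> \<le> Suc ((m - 1) + (m - 1))"
    using card_image_le[of "{1..<m}" "\<lambda>i. int (i mod l)"]
      card_image_le[of "{1..<m}" "\<lambda>i. int (i mod l) - int l"] by simp
  \<comment> \<open>Subtraction is truncated: for \<open>m = 0\<close> the left side would be 1 and
    the right side 0.\<close>
  also have "\<dots> = 2 * m - 1" using assms by simp
  finally show ?thesis .
qed

text \<open>The contribution of the row cancels. One column step moves the position by
  \<open>m\<close> in column-major order and by 1 in row-major order.\<close>

lemma flat_pos_diff_same_row:
  "int (flat_pos ord m l (i, j')) - int (flat_pos ord m l (i, j)) =
   (case ord of Column_Major \<Rightarrow> int m | Row_Major \<Rightarrow> 1) * (int j' - int j)"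
  by (cases ord) (simp_all add: algebra_simps)

text \<open>Only an inclusion is claimed: in the zero ring \<open>1 = 0\<close> and no diagonal is
  non-zero. An upper bound needs no more.\<close>

lemma nonzero_diagonals_U_sigma_subset:
  "nonzero_diagonals (U_sigma ord m l :: 'a::{zero, one} mat) \<subseteq>
   (*) (case ord of Column_Major \<Rightarrow> int m | Row_Major \<Rightarrow> 1) ` shifts m l"
proof
  let ?U = "U_sigma ord m l :: 'a mat"
  fix z assume "z \<in> nonzero_diagonals ?U"
  then obtain r c where rc: "r < m * l" "c < m * l" and z: "z = int c - int r"
    and "?U $$ (r, c) \<noteq> 0"
    by (auto simp: nonzero_diagonals_def diagonal_entries_def U_sigma_def)
  then obtain i j where ij: "i < m" "j < l"
    and "r = flat_pos ord m l (i, j)" "c = flat_pos ord m l (i, (i + j) mod l)"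
    by (auto simp: U_sigma_def split: if_splits)
  then have "z = (case ord of Column_Major \<Rightarrow> int m | Row_Major \<Rightarrow> 1)
      * (int ((i + j) mod l) - int j)"
    using z by (simp only: flat_pos_diff_same_row)
  moreover have "int ((i + j) mod l) - int j \<in> shifts m l"
    using ij by (auto simp: shifts_def)
  ultimately show "z \<in> (*) (case ord of Column_Major \<Rightarrow> int m | Row_Major \<Rightarrow> 1) ` shifts m l"
    by (rule image_eqI)
qed

theorem mainTheorem2:
  fixes m l :: nat and ord :: flat_order
  assumes "0 < m" and "0 < l"
  shows "card (nonzero_diagonals (U_sigma ord m l :: 'a::{comm_ring, monoid_mult} mat)) \<le> 2 * min m l - 1"
proof -
  have "card (nonzero_diagonals (U_sigma ord m l :: 'a mat)) \<le> card (shifts m l)"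
    \<comment> \<open>Scaling all shifts by a common factor cannot increase their number.\<close>
    using finite_shifts nonzero_diagonals_U_sigma_subset by (rule surj_card_le)
  also have "\<dots> \<le> 2 * min m l - 1"
    using card_shifts_le_rows[OF assms(1), of l] card_shifts_le_cols[OF assms(2), of m]
    by (simp add: min_def)
  finally show ?thesis .
qed

end
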